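(* Fix a state $x=(x_1,\dots,x_M)$. Suppose the opinion profile $(\mathcal C_{[1]}^e,\dots,\mathcal C_{[M]}^e)\in\Pi_{\mathcal M}^M$ is such that $J_i^{\mathrm{consensus}}=0$ for all $i\in\mathcal M=\{1,\dots,M\}$. If $\rho\sigma_{ij}<1$ for all $i,j$ and $\epsilon\ge0$ is sufficiently small (that is, $0\le\epsilon\le\bar\epsilon$ for a threshold $\bar\epsilon\ge0$ that may depend on the other data and may be zero), then $(\mathcal C_{[1]}^e,\dots,\mathcal C_{[M]}^e)$ is a Nash equilibrium of the game $(\mathcal M,\{\Pi_{\mathcal M}\}_i,\{J_i\}_i)$ with $J_i=J_i^{\mathrm{consensus}}+\rho J_i^{\mathrm{power}}$.
   Context: A linear system $x^+=Ax+Bu$ is partitioned into $M$ subsystems with states $x_i\in\mathbb R^{n_i}$; $A=[A_{ij}]$ in block form. The neighbours of $i\in\mathcal M$ are $\mathcal M_i=\{j\in\mathcal M\setminus\{i\}:A_{ij}\neq0\}$. $\Pi_{\mathcal M}$ is the set of all set partitions of $\mathcal M$ (blocks are called coalitions). For $\mathcal C\in\Pi_{\mathcal M}$, $\delta_{ij}(\mathcal C)=\delta_{ji}(\mathcal C)=0$ if $i,j$ belong to the same block of $\mathcal C$, and $1$ otherwise. Weights: $w_{ij}(x_i,x_j)=w_{ji}(x_j,x_i)=\frac12(\|A_{ij}\||x_j|+\|A_{ji}\||x_i|)$; $\sigma_{ij}=\sigma_{ji}>0$; $\rho>0$. For a profile $(\mathcal C_{[1]},\dots,\mathcal C_{[M]})$,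 $$J_i^{\mathrm{consensus}}=\sum_{j\in\mathcal M_i}w_{ij}(x_i,x_j)\,|\delta_{ij}(\mathcal C_{[i]})-\delta_{ij}(\mathcal C_{[j]})|,\qquad J_i^{\mathrm{power}}=\sum_{j\in\mathcal M_i}(w_{ij}(x_i,x_j)+\epsilon)\,\sigma_{ij}\,(1-\delta_{ij}(\mathcal C_{[i]})).$$ A profile is a Nash equilibrium if, for every $i$, $\mathcal C_{[i]}^e$ minimizes $J_i$ over all $\mathcal C_{[i]}\in\Pi_{\mathcal M}$ with the other opinions $\mathcal C_{[j]}^e$, $j\ne i$, fixed. The paper remarks that $\epsilon=0$ always counts as sufficiently small. *)

theory Defs
  imports Complex_Main "HOL-Library.Disjoint_Sets" "Jordan_Normal_Form.Matrix"
begin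

(* Subsystems are the indices in {1..M}.  The block A i j is the n i x n j matrix A_ij and x i
   is the state of subsystem i in R^(n i).  An opinion profile C assigns to each i a partition
   C i of {1..M}. *)

definition vec_norm :: "real vec \<Rightarrow> real" where
  "vec_norm v = sqrt (v \<bullet> v)"

(* Matrix norm induced by the Euclidean norms.  The supremum is over the unit ball and not the
   unit sphere, so that the set is nonempty also for matrices without columns. *)
definition mat_norm :: "real mat \<Rightarrow> real" where
  "mat_norm P = (SUP v \<in> {v \<in> carrier_vec (dim_col P). vec_norm v \<le> 1}. vec_norm (P *\<^sub>v v))"

definition set_partitions :: "nat \<Rightarrow> nat set set set" where
  "set_partitions M = {C. partition_on {1..M} C}"

definition neighbours :: "nat \<Rightarrow> (nat \<Rightarrow> nat) \<Rightarrow> (nat \<Rightarrow> nat \<Rightarrow> real mat) \<Rightarrow> nat \<Rightarrow> nat set" where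
  "neighbours M n A i = {j \<in> {1..M} - {i}. A i j \<noteq> 0\<^sub>m (n i) (n j)}"

definition delta :: "nat set set \<Rightarrow> nat \<Rightarrow> nat \<Rightarrow> real" where
  "delta C i j = (if \<exists>B\<in>C. i \<in> B \<and> j \<in> B then 0 else 1)"

definition weight :: "(nat \<Rightarrow> nat \<Rightarrow> real mat) \<Rightarrow> (nat \<Rightarrow> real vec) \<Rightarrow> nat \<Rightarrow> nat \<Rightarrow> real" where
  "weight A x i j = 1 / 2 * (mat_norm (A i j) * vec_norm (x j) + mat_norm (A j i) * vec_norm (x i))"

definition J_consensus ::
  "nat \<Rightarrow> (nat \<Rightarrow> nat) \<Rightarrow> (nat \<Rightarrow> nat \<Rightarrow> real mat) \<Rightarrow> (nat \<Rightarrow> real vec) \<Rightarrow>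
    nat \<Rightarrow> (nat \<Rightarrow> nat set set) \<Rightarrow> real" where
  "J_consensus M n A x i C =
    (\<Sum>j\<in>neighbours M n A i. weight A x i j * \<bar>delta (C i) i j - delta (C j) i j\<bar>)"

definition J_power ::
  "nat \<Rightarrow> (nat \<Rightarrow> nat) \<Rightarrow> (nat \<Rightarrow> nat \<Rightarrow> real mat) \<Rightarrow> (nat \<Rightarrow> real vec) \<Rightarrow>
    (nat \<Rightarrow> nat \<Rightarrow> real) \<Rightarrow> real \<Rightarrow> nat \<Rightarrow> (nat \<Rightarrow> nat set set) \<Rightarrow> real" where
  "J_power M n A x \<sigma> \<epsilon> i C =
    (\<Sum>j\<in>neighbours M n A i. (weight A x i j + \<epsilon>) * \<sigma> i j * (1 - delta (C i) i j))"

definition J_total ::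
  "nat \<Rightarrow> (nat \<Rightarrow> nat) \<Rightarrow> (nat \<Rightarrow> nat \<Rightarrow> real mat) \<Rightarrow> (nat \<Rightarrow> real vec) \<Rightarrow>
    (nat \<Rightarrow> nat \<Rightarrow> real) \<Rightarrow> real \<Rightarrow> real \<Rightarrow> nat \<Rightarrow> (nat \<Rightarrow> nat set set) \<Rightarrow> real" where
  "J_total M n A x \<sigma> \<rho> \<epsilon> i C = J_consensus M n A x i C + \<rho> * J_power M n A x \<sigma> \<epsilon> i C"

definition nash_equilibrium ::
  "'p set \<Rightarrow> ('p \<Rightarrow> 's set) \<Rightarrow> ('p \<Rightarrow> ('p \<Rightarrow> 's) \<Rightarrow> real) \<Rightarrow> ('p \<Rightarrow> 's) \<Rightarrow> bool" where
  "nash_equilibrium I S J e \<longleftrightarrow>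
    (\<forall>i\<in>I. is_arg_min (\<lambda>c. J i (e(i := c))) (\<lambda>c. c \<in> S i) (e i))"

end

theory Submission
  imports Defs "HOL-Analysis.L2_Norm"
begin

text \<open>At zero consensus cost, every neighbour \<open>j\<close> of \<open>i\<close> with positive weight agrees with \<open>i\<close> on
  whether the two cooperate.  A deviation of \<open>i\<close> on this link costs \<open>w\<^sub>i\<^sub>j\<close> in consensus
  and saves at most \<open>\<rho>\<sigma>\<^sub>i\<^sub>jw\<^sub>i\<^sub>j \<le> w\<^sub>i\<^sub>j\<close> in power, so no deviation pays off.
  On links of weight zero nothing is known about agreement, so for \<open>\<epsilon> > 0\<close> a deviation there may
  pay off; the threshold is therefore taken to be zero.\<close>

lemma vec_norm_conv_L2_set: "vec_norm v = L2_set (($) v) {0..<dim_vec v}"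
  by (simp add: vec_norm_def L2_set_def scalar_prod_def power2_eq_square)

lemma vec_norm_nonneg: "vec_norm v \<ge> 0"
  by (simp add: vec_norm_conv_L2_set)

text \<open>A crude bound, with the absolute sum of all entries as constant: it is enough to show
  that the supremum in \<open>mat_norm\<close> runs over a bounded set.\<close>

lemma vec_norm_mult_mat_vec_le:
  assumes v: "v \<in> carrier_vec (dim_col P)"
  shows "vec_norm (P *\<^sub>v v) \<le> (\<Sum>k<dim_row P. \<Sum>j<dim_col P. \<bar>P $$ (k, j)\<bar>) * vec_norm v"
proof -
  \<comment> \<open>Passing to absolute values leaves the Euclidean norm unchanged and bounds both
    signs of \<open>v $ j\<close> at once.\<close>
  have entry: "\<bar>v $ j\<bar> \<le> vec_norm v" if "j < dim_col P" for j
    using member_le_L2_set[of "{0..<dim_vec v}" j "\<lambda>k. \<bar>v $ k\<bar>"] that v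
    by (simp add: vec_norm_conv_L2_set L2_set_def)
  have "vec_norm (P *\<^sub>v v) \<le> (\<Sum>k<dim_row P. \<bar>(P *\<^sub>v v) $ k\<bar>)"
    using L2_set_le_sum_abs[of "($) (P *\<^sub>v v)" "{0..<dim_row P}"]
    by (simp add: vec_norm_conv_L2_set atLeast0LessThan)
  also have "\<dots> \<le> (\<Sum>k<dim_row P. \<Sum>j<dim_col P. \<bar>P $$ (k, j)\<bar> * vec_norm v)"
  proof (rule sum_mono)
    fix k assume "k \<in> {..<dim_row P}"
    then have "(P *\<^sub>v v) $ k = (\<Sum>j<dim_col P. P $$ (k, j) * v $ j)"
      using v by (simp add: scalar_prod_def atLeast0LessThan)
    also have "\<bar>\<dots>\<bar> \<le> (\<Sum>j<dim_col P. \<bar>P $$ (k, j) * v $ j\<bar>)"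
      by (rule sum_abs)
    also have "\<dots> \<le> (\<Sum>j<dim_col P. \<bar>P $$ (k, j)\<bar> * vec_norm v)"
      using entry by (intro sum_mono) (simp add: abs_mult mult_left_mono)
    finally show "\<bar>(P *\<^sub>v v) $ k\<bar> \<le> (\<Sum>j<dim_col P. \<bar>P $$ (k, j)\<bar> * vec_norm v)" .
  qed
  finally show ?thesis
    by (simp add: sum_distrib_right)
qed

text \<open>A real \<open>SUP\<close> dominates the members of its set only once the set is known to
  be bounded above; any single member, being a norm, then gives the sign.\<close>

lemma mat_norm_nonneg: "mat_norm P \<ge> 0"
proof -
  let ?B = "{v \<in> carrier_vec (dim_col P). vec_norm v \<le> 1}"
  let ?K = "\<Sum>k<dim_row P. \<Sum>j<dim_col P. \<bar>P $$ (k, j)\<bar>"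
  have "bdd_above ((\<lambda>v. vec_norm (P *\<^sub>v v)) ` ?B)"
  proof (rule bdd_aboveI2)
    fix v assume "v \<in> ?B"
    then have "vec_norm (P *\<^sub>v v) \<le> ?K * vec_norm v" "vec_norm v \<le> 1"
      by (simp_all add: vec_norm_mult_mat_vec_le)
    moreover have "?K \<ge> 0"
      by (intro sum_nonneg) simp
    ultimately show "vec_norm (P *\<^sub>v v) \<le> ?K"
      by (meson mult_left_le order_trans)
  qed
  \<comment> \<open>The zero vector lies in the unit ball in every dimension, also when
    \<open>P\<close> has no columns.\<close>
  moreover have "0\<^sub>v (dim_col P) \<in> ?B"
    by (simp add: vec_norm_def)
  ultimately have "vec_norm (P *\<^sub>v 0\<^sub>v (dim_col P)) \<le> mat_norm P"
    unfolding mat_norm_def by (rule cSUP_upper[rotated])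
  then show ?thesis
    using vec_norm_nonneg order_trans by blast
qed

lemma weight_nonneg: "weight A x i j \<ge> 0"
  by (simp add: weight_def mat_norm_nonneg vec_norm_nonneg)

lemma finite_neighbours: "finite (neighbours M n A i)"
  by (simp add: neighbours_def)

text \<open>Nonnegative summands cannot cancel, so each product vanishes separately.\<close>

lemma J_consensus_eq_0_iff:
  "J_consensus M n A x i C = 0 \<longleftrightarrow>
    (\<forall>j\<in>neighbours M n A i. weight A x i j = 0 \<or> delta (C i) i j = delta (C j) i j)"
  by (simp add: J_consensus_def finite_neighbours sum_nonneg_eq_0_iff weight_nonneg)

lemma J_total_deviation_ge:
  assumes consensus: "J_consensus M n A x i C = 0"
    and bounds: "\<And>j. j \<in> neighbours M n A i \<Longrightarrow> 0 \<le> \<rho> * \<sigma> i j \<and> \<rho> * \<sigma> i j \<le> 1"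
  shows "J_total M n A x \<sigma> \<rho> 0 i C \<le> J_total M n A x \<sigma> \<rho> 0 i (C(i := c))"
proof -
  let ?w = "weight A x i"
  have "\<rho> * (?w j * \<sigma> i j * (1 - delta (C i) i j))
      \<le> ?w j * \<bar>delta c i j - delta (C j) i j\<bar> + \<rho> * (?w j * \<sigma> i j * (1 - delta c i j))"
    if j: "j \<in> neighbours M n A i" for j
  \<comment> \<open>On a link of weight zero both sides vanish, as \<epsilon> is zero here.\<close>
  proof (cases "?w j = 0")
    case False
    with consensus j have "delta (C i) i j = delta (C j) i j"
      by (auto simp: J_consensus_eq_0_iff)
    moreover have "0 \<le> (\<rho> * \<sigma> i j) * ?w j" "(\<rho> * \<sigma> i j) * ?w j \<le> ?w j"
      using bounds[OF j] weight_nonneg[of A x i j]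
      by (simp, metis mult_left_le_one_le)
    \<comment> \<open>The cases are the 0/1 values of \<open>delta\<close>. Leaving a shared block
      saves \<open>\<rho> * \<sigma> i j * ?w j\<close> and costs \<open>?w j\<close>; joining a
      block only adds cost; keeping the relation changes nothing.\<close>
    ultimately show ?thesis
      using weight_nonneg[of A x i j] by (auto simp: delta_def algebra_simps)
  qed simp
  then have "\<rho> * J_power M n A x \<sigma> 0 i C
      \<le> (\<Sum>j\<in>neighbours M n A i. ?w j * \<bar>delta c i j - delta (C j) i j\<bar>
          + \<rho> * (?w j * \<sigma> i j * (1 - delta c i j)))"
    unfolding J_power_def sum_distrib_left by (intro sum_mono) simp
  \<comment> \<open>Since \<open>i\<close> is not its own neighbour, the update at \<open>i\<close>
    leaves every \<open>C j\<close> in the sum intact.\<close>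
  also have "\<dots> = J_total M n A x \<sigma> \<rho> 0 i (C(i := c))"
    unfolding J_total_def J_power_def J_consensus_def sum_distrib_left sum.distrib[symmetric]
    by (intro sum.cong) (auto simp: neighbours_def)
  finally show ?thesis
    using consensus by (simp add: J_total_def)
qed

theorem theorem4p3:
  fixes M :: nat
    and n :: "nat \<Rightarrow> nat"
    and A :: "nat \<Rightarrow> nat \<Rightarrow> real mat"
    and x :: "nat \<Rightarrow> real vec"
    and \<sigma> :: "nat \<Rightarrow> nat \<Rightarrow> real"
    and \<rho> :: real
    and C :: "nat \<Rightarrow> nat set set"
  assumes "\<And>i j. i \<in> {1..M} \<Longrightarrow> j \<in> {1..M} \<Longrightarrow> A i j \<in> carrier_mat (n i) (n j)"
    and "\<And>i. i \<in> {1..M} \<Longrightarrow> x i \<in> carrier_vec (n i)"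
    and "\<And>i j. i \<in> {1..M} \<Longrightarrow> j \<in> {1..M} \<Longrightarrow> \<sigma> i j = \<sigma> j i"
    and "\<And>i j. i \<in> {1..M} \<Longrightarrow> j \<in> {1..M} \<Longrightarrow> \<sigma> i j > 0"
    and "\<rho> > 0"
    and "\<And>i. i \<in> {1..M} \<Longrightarrow> C i \<in> set_partitions M"
    and "\<And>i. i \<in> {1..M} \<Longrightarrow> J_consensus M n A x i C = 0"
    and "\<And>i j. i \<in> {1..M} \<Longrightarrow> j \<in> {1..M} \<Longrightarrow> \<rho> * \<sigma> i j < 1"
  shows "\<exists>\<epsilon>max\<ge>0. \<forall>\<epsilon>. 0 \<le> \<epsilon> \<and> \<epsilon> \<le> \<epsilon>max \<longrightarrow>
    nash_equilibrium {1..M} (\<lambda>_. set_partitions M) (J_total M n A x \<sigma> \<rho> \<epsilon>) C"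
proof (intro exI[of _ "0 :: real"] conjI allI impI)
  fix \<epsilon> :: real
  assume "0 \<le> \<epsilon> \<and> \<epsilon> \<le> 0"
  then have "\<epsilon> = 0"
    by simp
  have "J_total M n A x \<sigma> \<rho> 0 i C \<le> J_total M n A x \<sigma> \<rho> 0 i (C(i := c))"
    if i: "i \<in> {1..M}" for i c
  proof (rule J_total_deviation_ge)
    show "J_consensus M n A x i C = 0"
      by (rule assms(7)) (rule i)
    fix j assume "j \<in> neighbours M n A i"
    then have "j \<in> {1..M}"
      by (simp add: neighbours_def)
    then show "0 \<le> \<rho> * \<sigma> i j \<and> \<rho> * \<sigma> i j \<le> 1"
      using assms(4)[OF i] assms(5) assms(8)[OF i] by (simp add: less_imp_le)
  qed
  \<comment> \<open>\<open>is_arg_min\<close> forbids strictly cheaper choices, and re-inserting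
    \<open>C i\<close> at \<open>i\<close> gives back \<open>C\<close>.\<close>
  then show "nash_equilibrium {1..M} (\<lambda>_. set_partitions M) (J_total M n A x \<sigma> \<rho> \<epsilon>) C"
    using assms(6) \<open>\<epsilon> = 0\<close> by (simp add: nash_equilibrium_def is_arg_min_def not_less)
qed simp

end
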